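(* Let $s,r,m$ be positive integers with $s\le r\le sm$, and put $n=sm$, $k=n-r$, $l=s^m$. Let $F$ be a finite field with $|F|\ge n$, let $\lambda_1,\dots,\lambda_n$ be distinct elements of $F$, and let $\gamma\in F\setminus\{0,1\}$. Let $\mathcal C\subseteq (F^l)^n$ be the array code $$\mathcal C=\Big\{(C_1,\dots,C_n)\in (F^l)^n:\ \sum_{i=1}^n A_{t,i}C_i=0,\ t=0,1,\dots,r-1\Big\},$$ where the $l\times l$ matrices $A_{t,i}$ are those defined in the context. Then $\mathcal C$ is an $(n=sm,\ k=n-r,\ l=s^m)$ MDS array code.
   Context: Conventions: $[n]=\{1,\dots,n\}$; $0^0=1$. Rows and columns of an $l\times l$ matrix $A$ are indexed by $0,1,\dots,l-1$, and $A(a,b)$ denotes the entry in row $a$, column $b$. An $(n,k,l)$ array code over $F$ (length $n$, dimension $k$, sub-packetization $l$) is an $F$-linear subspace $\mathcal C\subseteq(F^l)^n$ with $\dim_F\mathcal C=kl$; its codewords are written $(C_1,\dots,C_n)$ with $C_i\in F^l$. It is MDS if any $k$ of the $n$ columns $C_i$ of a codeword suffice to recover the remaining $r=n-k$ columns (i.e. two codewords that agree in any $k$ of the coordinates $C_i$ are equal). The matrices $A_{t,i}$. For an integer $a$ with $0\le a\le l-1$, write its $s$-ary expansion as $a=(a_m,a_{m-1},\dots,a_1)$, i.e. $a=\sum_{v=1}^m a_v s^{v-1}$ with $0\le a_v\le s-1$. For $v\in[m]$ and $0\le u\le s-1$ let $a(v,u)$ be the integer obtained from $a$ by replacing the digit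 $a_v$ by $u$ and keeping all other digits. Each $i\in[n]$ is written uniquely as $i=(v-1)s+u+1$ with $v\in[m]$, $u\in\{0,\dots,s-1\}$. For $t=0,\dots,r-1$ and $0\le a,b\le l-1$, $$A_{t,(v-1)s+u+1}(a,b)=\begin{cases}\lambda_{(v-1)s+u+1}^t & \text{if } a_v<u,\ b=a,\\ \gamma\lambda_{(v-1)s+u+1}^t & \text{if } a_v>u,\ b=a,\\ \lambda_{(v-1)s+w+1}^t & \text{if } a_v=u,\ b=a(v,w)\text{ for some } w\in\{0,1,\dots,s-1\},\\ 0&\text{otherwise.}\end{cases}$$ *)

theory Defs
  imports Complex_Main "HOL-Library.Function_Algebras"
begin

text \<open>
  An element \<open>C\<close> of \<open>(F\<^sup>l)\<^sup>n\<close> is a function with \<open>C i a\<close> the entry \<open>a\<close> (counted from 0) of the column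
  \<open>C\<^sub>i\<close> (counted from 1).  It is 0 outside the index range, so that equality of columns and of
  codewords is equality of functions.
\<close>

type_synonym 'a array = "nat \<Rightarrow> nat \<Rightarrow> 'a"

definition array_space :: "nat \<Rightarrow> nat \<Rightarrow> 'a::zero array set" where
  "array_space n l = {C. \<forall>i a. i \<notin> {1..n} \<or> a \<ge> l \<longrightarrow> C i a = 0}"

definition array_scale :: "'a::field \<Rightarrow> 'a array \<Rightarrow> 'a array" where
  "array_scale c C = (\<lambda>i a. c * C i a)"

global_interpretation arr: vector_space array_scale
  by unfold_locales (auto simp: array_scale_def fun_eq_iff algebra_simps)

definition array_code :: "nat \<Rightarrow> nat \<Rightarrow> nat \<Rightarrow> 'a::field array set \<Rightarrow> bool" where
  "array_code n k l \<C> \<longleftrightarrow> \<C> \<subseteq> array_space n l \<and> arr.subspace \<C> \<and> arr.dim \<C> = k * l"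

definition MDS_array_code :: "nat \<Rightarrow> nat \<Rightarrow> nat \<Rightarrow> 'a::field array set \<Rightarrow> bool" where
  "MDS_array_code n k l \<C> \<longleftrightarrow> array_code n k l \<C> \<and>
    (\<forall>S \<subseteq> {1..n}. card S = k \<longrightarrow>
      (\<forall>C \<in> \<C>. \<forall>D \<in> \<C>. (\<forall>i \<in> S. C i = D i) \<longrightarrow> C = D))"

definition digit :: "nat \<Rightarrow> nat \<Rightarrow> nat \<Rightarrow> nat" where
  "digit s a v = a div s ^ (v - 1) mod s"

definition set_digit :: "nat \<Rightarrow> nat \<Rightarrow> nat \<Rightarrow> nat \<Rightarrow> nat" where
  "set_digit s a v u = a - digit s a v * s ^ (v - 1) + u * s ^ (v - 1)"

lemma digit_expansion: "a < s ^ m \<Longrightarrow> (\<Sum>v=1..m. digit s a v * s ^ (v - 1)) = a"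
proof (induction m arbitrary: a)
  case (Suc m)
  have "s > 0" using Suc.prems by (cases s) auto
  have "digit s a v = digit s (a mod s ^ m) v" if "v \<in> {1..m}" for v
  proof -
    define j where "j = m - v"
    have j: "m = (v - 1) + Suc j"
      using that by (auto simp: j_def)
    have "a mod s ^ m div s ^ (v - 1) = a div s ^ (v - 1) mod s ^ Suc j"
      using \<open>s > 0\<close> by (subst j, subst power_add, subst mod_mult2_eq) simp
    then show ?thesis by (simp add: digit_def mod_mod_cancel)
  qed
  then have "(\<Sum>v=1..m. digit s a v * s ^ (v - 1)) = a mod s ^ m"
    using Suc.IH[of "a mod s ^ m"] \<open>s > 0\<close> by simp
  moreover have "digit s a (Suc m) = a div s ^ m"
    using Suc.prems \<open>s > 0\<close> by (simp add: digit_def less_mult_imp_div_less)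
  ultimately show ?case by (simp add: mod_div_mult_eq)
qed simp

lemma digit_set_digit:
  assumes "u < s"
  shows "digit s (set_digit s a v u) v = u"
proof -
  define p where "p = s ^ (v - 1)"
  have "p > 0" using assms by (simp add: p_def)
  have "a = a mod p + (digit s a v + s * (a div p div s)) * p"
    unfolding digit_def p_def[symmetric] by (simp only: mod_mult_div_eq mod_div_mult_eq)
  then have "a - digit s a v * p = a mod p + s * (a div p div s) * p"
    unfolding distrib_right by linarith
  then have "set_digit s a v u = a mod p + (u + s * (a div p div s)) * p"
    unfolding set_digit_def p_def[symmetric] by (simp add: algebra_simps)
  then show ?thesis
    unfolding digit_def p_def[symmetric] using \<open>p > 0\<close> assms by simp
qed

text \<open>
  The entry \<open>A\<^sub>t\<^sub>,\<^sub>i(a, b)\<close>, for \<open>i = (v - 1) s + u + 1\<close>.  In the third case \<open>b = a(v, w)\<close> with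
  \<open>w < s\<close>, and this \<open>w\<close> is the \<open>v\<close>-th digit of \<open>b\<close> (lemma \<open>digit_set_digit\<close>); the lemma
  \<open>A_mat_node\<close> below restates the definition in terms of \<open>v\<close>, \<open>u\<close> and \<open>w\<close>.
\<close>

definition A_mat :: "nat \<Rightarrow> (nat \<Rightarrow> 'a::field) \<Rightarrow> 'a \<Rightarrow> nat \<Rightarrow> nat \<Rightarrow> nat \<Rightarrow> nat \<Rightarrow> 'a" where
  "A_mat s lam \<gamma> t i a b =
    (let v = (i - 1) div s + 1; u = (i - 1) mod s in
     if digit s a v < u \<and> b = a then lam i ^ t
     else if digit s a v > u \<and> b = a then \<gamma> * lam i ^ t
     else if digit s a v = u \<and> (\<exists>w<s. b = set_digit s a v w)
       then lam ((v - 1) * s + digit s b v + 1) ^ t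
     else 0)"

lemma A_mat_node:
  assumes "v \<ge> 1" "u < s"
  defines "i \<equiv> (v - 1) * s + u + 1"
  shows "digit s a v < u \<Longrightarrow> A_mat s lam \<gamma> t i a a = lam i ^ t"
    and "digit s a v > u \<Longrightarrow> A_mat s lam \<gamma> t i a a = \<gamma> * lam i ^ t"
    and "digit s a v = u \<Longrightarrow> w < s \<Longrightarrow>
      A_mat s lam \<gamma> t i a (set_digit s a v w) = lam ((v - 1) * s + w + 1) ^ t"
    and "digit s a v \<noteq> u \<Longrightarrow> b \<noteq> a \<Longrightarrow> A_mat s lam \<gamma> t i a b = 0"
    and "digit s a v = u \<Longrightarrow> \<forall>w<s. b \<noteq> set_digit s a v w \<Longrightarrow> A_mat s lam \<gamma> t i a b = 0"
proof -
  have "(i - 1) div s + 1 = v" "(i - 1) mod s = u"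
    using assms by auto
  note A = A_mat_def[of s lam \<gamma> t i, unfolded this Let_def]
  show "digit s a v < u \<Longrightarrow> A_mat s lam \<gamma> t i a a = lam i ^ t"
    "digit s a v > u \<Longrightarrow> A_mat s lam \<gamma> t i a a = \<gamma> * lam i ^ t"
    "digit s a v = u \<Longrightarrow> w < s \<Longrightarrow>
      A_mat s lam \<gamma> t i a (set_digit s a v w) = lam ((v - 1) * s + w + 1) ^ t"
    "digit s a v \<noteq> u \<Longrightarrow> b \<noteq> a \<Longrightarrow> A_mat s lam \<gamma> t i a b = 0"
    "digit s a v = u \<Longrightarrow> \<forall>w<s. b \<noteq> set_digit s a v w \<Longrightarrow> A_mat s lam \<gamma> t i a b = 0"
    unfolding A by (auto simp: digit_set_digit)
qed

definition mat_vec :: "nat \<Rightarrow> (nat \<Rightarrow> nat \<Rightarrow> 'a::field) \<Rightarrow> (nat \<Rightarrow> 'a) \<Rightarrow> nat \<Rightarrow> 'a" where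
  "mat_vec l A x = (\<lambda>a. \<Sum>b<l. A a b * x b)"

definition code :: "nat \<Rightarrow> nat \<Rightarrow> nat \<Rightarrow> (nat \<Rightarrow> 'a::field) \<Rightarrow> 'a \<Rightarrow> 'a array set" where
  "code s r m lam \<gamma> =
    {C \<in> array_space (s * m) (s ^ m).
      \<forall>t<r. \<forall>a<s ^ m. (\<Sum>i=1..s * m. mat_vec (s ^ m) (A_mat s lam \<gamma> t i) (C i) a) = 0}"

end

(*
  Row a of the parity check equations reads sum_i lambda_i^t D_i(a) = 0 for all t < r, where D_i(a)
  is an entry of C or a combination of two entries, in the rows a and a(v,u) of the same block v.
  Suppose that C vanishes outside a set T of r columns, and induct on the number of blocks v for
  which the column (v, a_v) lies in T.  For (v,u) outside T, D_{v,u}(a) reduces to the entry of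
  column (v, a_v) in row a(v,u), which is zero because either (v, a_v) is outside T or a(v,u) has
  fewer such blocks than a.  So D(a) is supported on T and vanishes by Vandermonde.  The unknowns of
  columns (v,u) and (v, a_v) in T are then separated by comparing the rows a and a(v,u), where the
  factor gamma sits on different unknowns; this uses gamma distinct from 0 and 1.
  The dimension follows by counting over the finite field: there are only r l equations, and a
  codeword is determined by any k columns.
*)

theory Submission
  imports Defs "HOL-Computational_Algebra.Polynomial" "HOL-Library.FuncSet" "HOL-Library.Cardinality"
begin

subsection \<open>Digits\<close>

text \<open>Splitting \<open>a\<close> into the digits below position \<open>v\<close>, digit
  \<open>v\<close> and the digits above removes the truncated subtraction from
  \<open>set_digit\<close>, so that remainders and quotients by powers of \<open>s\<close> can be
  computed.\<close>

lemma set_digit_eq: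
  "set_digit s a v u = a mod s ^ (v - 1) + (u + s * (a div s ^ (v - 1) div s)) * s ^ (v - 1)"
proof -
  define p where "p = s ^ (v - 1)"
  have "a = a mod p + (digit s a v + s * (a div p div s)) * p"
    unfolding digit_def p_def[symmetric] by (simp only: mod_mult_div_eq mod_div_mult_eq)
  then have "a - digit s a v * p = a mod p + s * (a div p div s) * p"
    unfolding distrib_right by linarith
  then show ?thesis
    unfolding set_digit_def p_def[symmetric] by (simp add: algebra_simps)
qed

lemma set_digit_mod: "set_digit s a v u mod s ^ (v - 1) = a mod s ^ (v - 1)"
  by (simp add: set_digit_eq)

lemma set_digit_div:
  assumes "u < s"
  shows "set_digit s a v u div s ^ (v - 1) div s = a div s ^ (v - 1) div s"
  using assms by (simp add: set_digit_eq)

lemma digit_less: "0 < s \<Longrightarrow> digit s a v < s"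
  by (simp add: digit_def)

lemma set_digit_digit: "set_digit s a v (digit s a v) = a"
  unfolding set_digit_eq by (simp add: digit_def mod_div_mult_eq)

lemma set_digit_set_digit:
  "u < s \<Longrightarrow> set_digit s (set_digit s a v u) v w = set_digit s a v w"
  by (simp only: set_digit_eq[of s "set_digit s a v u" v w] set_digit_mod set_digit_div
      set_digit_eq[of s a v w])

text \<open>Being below \<open>s ^ m\<close> depends only on the quotient formed by the digits above
  position \<open>v\<close>, which the replacement leaves alone.\<close>

lemma set_digit_less:
  assumes "a < s ^ m" "v \<in> {1..m}" "u < s"
  shows "set_digit s a v u < s ^ m"
proof -
  have "s ^ m = s ^ (m - v + Suc (v - 1))"
    using assms(2) by simp
  then have m: "s ^ m = s ^ (m - v) * s * s ^ (v - 1)"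
    by (simp only: power_add power_Suc mult.assoc)
  have less: "x < s ^ m \<longleftrightarrow> x div s ^ (v - 1) div s < s ^ (m - v)" for x
    using assms(3) unfolding m by (simp add: div_less_iff_less_mult)
  show ?thesis
    using assms(1) unfolding less set_digit_div[OF assms(3)] .
qed

text \<open>Digits below position \<open>v\<close> are read off the remainder modulo
  \<open>s ^ (v - 1)\<close>, digits above it off the quotient by \<open>s ^ v\<close>; the
  replacement preserves both.\<close>

lemma digit_set_digit_other:
  assumes "u < s" "v \<ge> 1" "w \<ge> 1" "w \<noteq> v"
  shows "digit s (set_digit s a v u) w = digit s a w"
proof (cases "w < v")
  case True
  define j where "j = v - w - 1"
  have v: "v - 1 = (w - 1) + Suc j"
    using True assms by (simp add: j_def)
  have *: "digit s x w = digit s (x mod s ^ (v - 1)) w" for x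
  proof -
    have "x mod s ^ (v - 1) div s ^ (w - 1) = x div s ^ (w - 1) mod s ^ Suc j"
      using \<open>u < s\<close> by (subst v, subst power_add, subst mod_mult2_eq) simp
    then show ?thesis by (simp add: digit_def mod_mod_cancel)
  qed
  show ?thesis
    by (subst (1 2) *) (simp only: set_digit_mod)
next
  case False
  define j where "j = w - v - 1"
  have w: "w - 1 = (v - 1) + Suc j"
    using False assms by (simp add: j_def)
  have *: "digit s x w = x div s ^ (v - 1) div s div s ^ j mod s" for x
    unfolding digit_def w by (simp only: power_add power_Suc div_mult2_eq)
  show ?thesis
    unfolding * set_digit_div[OF assms(1)] ..
qed

subsection \<open>Vandermonde systems\<close>

text \<open>Combine the equations with the coefficients of the product of the X - \<open>x j\<close>
  over all j in \<open>T\<close> other than \<open>i\<close>. Its degree is below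
  \<open>card T\<close>, and as it vanishes at every node except \<open>x i\<close>, only a nonzero
  multiple of \<open>d i\<close> survives.\<close>

lemma vandermonde_system_zero:
  fixes x d :: "'b \<Rightarrow> 'a::field"
  assumes "finite T" "inj_on x T"
    and sys: "\<And>t. t < card T \<Longrightarrow> (\<Sum>i\<in>T. x i ^ t * d i) = 0"
    and "i \<in> T"
  shows "d i = 0"
proof -
  define p where "p = (\<Prod>j\<in>T - {i}. [:- x j, 1:])"
  have "degree p < card T"
  proof -
    have "degree p \<le> (\<Sum>j\<in>T - {i}. degree [:- x j, 1:])"
      unfolding p_def by (rule order.trans[OF degree_prod_sum_le]) (use assms in auto)
    also have "\<dots> = card (T - {i})" by simp
    also have "\<dots> < card T" by (rule psubset_card_mono) (use assms in auto)
    finally show ?thesis .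
  qed
  have "(\<Sum>j\<in>T. poly p (x j) * d j) = (\<Sum>j\<in>T. \<Sum>t\<le>degree p. coeff p t * (x j ^ t * d j))"
    by (simp add: poly_altdef sum_distrib_right mult.assoc)
  also have "\<dots> = (\<Sum>t\<le>degree p. coeff p t * (\<Sum>j\<in>T. x j ^ t * d j))"
    by (subst sum.swap) (simp add: sum_distrib_left)
  also have "\<dots> = 0"
    using \<open>degree p < card T\<close> by (intro sum.neutral) (simp add: sys)
  finally have "(\<Sum>j\<in>T. poly p (x j) * d j) = 0" .
  moreover have "(\<Sum>j\<in>T. poly p (x j) * d j) = poly p (x i) * d i"
  proof (subst sum.remove[OF \<open>finite T\<close> \<open>i \<in> T\<close>])
    have "poly p (x j) = 0" if "j \<in> T - {i}" for j
      unfolding p_def poly_prod by (rule prod_zero) (use that assms in auto)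
    then show "poly p (x i) * d i + (\<Sum>j\<in>T - {i}. poly p (x j) * d j) = poly p (x i) * d i"
      by simp
  qed
  moreover have "poly p (x i) \<noteq> 0"
    unfolding p_def poly_prod using assms by (auto simp: inj_on_def)
  ultimately show ?thesis by simp
qed

subsection \<open>The parity check equations\<close>

definition node :: "nat \<Rightarrow> nat \<Rightarrow> nat \<Rightarrow> nat" where
  "node s v u = (v - 1) * s + u + 1"

lemma bij_betw_node:
  assumes "0 < s"
  shows "bij_betw (\<lambda>(v, u). node s v u) ({1..m} \<times> {..<s}) {1..s * m}"
proof (rule bij_betwI[where g = "\<lambda>i. ((i - 1) div s + 1, (i - 1) mod s)"])
  show "(\<lambda>(v, u). node s v u) \<in> {1..m} \<times> {..<s} \<rightarrow> {1..s * m}"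
  proof clarsimp
    fix v u assume "Suc 0 \<le> v" "v \<le> m" "u < s"
    then have "(v - 1) * s + u < v * s"
      using assms by (cases v) auto
    also have "\<dots> \<le> m * s" using \<open>v \<le> m\<close> by simp
    finally show "Suc 0 \<le> node s v u \<and> node s v u \<le> s * m"
      by (simp add: node_def mult.commute)
  qed
  show "(\<lambda>i. ((i - 1) div s + 1, (i - 1) mod s)) \<in> {1..s * m} \<rightarrow> {1..m} \<times> {..<s}"
    using assms by (auto simp: less_eq_Suc_le[symmetric] div_less_iff_less_mult mult.commute)
qed (auto simp: node_def)

text \<open>
  The coefficient of \<open>\<lambda>\<^sub>i\<^sup>t\<close>, for \<open>i = node s v u\<close>, in row \<open>a\<close> of the \<open>t\<close>-th parity check equation; it
  does not depend on \<open>t\<close>, so that each row is a Vandermonde system.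
\<close>

definition row_coeff :: "nat \<Rightarrow> 'a::field \<Rightarrow> 'a array \<Rightarrow> nat \<Rightarrow> nat \<Rightarrow> nat \<Rightarrow> 'a" where
  "row_coeff s \<gamma> C a v u =
    (if u = digit s a v then C (node s v u) a
     else (if digit s a v < u then 1 else \<gamma>) * C (node s v u) a
       + C (node s v (digit s a v)) (set_digit s a v u))"

text \<open>Let d be digit \<open>v\<close> of \<open>a\<close>. Each column u \<noteq> d of the
  block meets row \<open>a\<close> only on the diagonal, while column d contributes one entry for
  every w, weighted by the power of \<open>lam (node s v w)\<close>. Collecting the terms with the
  same \<open>lam\<close> gives \<open>row_coeff\<close>.\<close>

lemma block_eq:
  assumes "0 < s" "a < s ^ m" "v \<in> {1..m}"
  shows "(\<Sum>u<s. mat_vec (s ^ m) (A_mat s lam \<gamma> t (node s v u)) (C (node s v u)) a) =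
    (\<Sum>u<s. lam (node s v u) ^ t * row_coeff s \<gamma> C a v u)"
proof -
  define d where "d = digit s a v"
  have d: "d < s" using assms by (simp add: d_def digit_less)
  have v: "v \<ge> 1" using assms by simp
  note A = A_mat_node[OF v, folded node_def]
  let ?e = "\<lambda>u. if d < u then 1 else \<gamma>"
  have off: "mat_vec (s ^ m) (A_mat s lam \<gamma> t (node s v u)) (C (node s v u)) a =
      lam (node s v u) ^ t * (?e u * C (node s v u) a)" if "u < s" "u \<noteq> d" for u
  proof -
    have "mat_vec (s ^ m) (A_mat s lam \<gamma> t (node s v u)) (C (node s v u)) a =
        (\<Sum>b\<in>{a}. A_mat s lam \<gamma> t (node s v u) a b * C (node s v u) b)"
      unfolding mat_vec_def
      by (rule sum.mono_neutral_right)
        (use assms that A(4)[OF that(1) that(2)[symmetric, unfolded d_def]] in \<open>auto simp: d_def\<close>)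
    moreover have "A_mat s lam \<gamma> t (node s v u) a a = ?e u * lam (node s v u) ^ t"
      using that A(1,2)[of u s a lam \<gamma> t] by (auto simp: d_def)
    ultimately show ?thesis
      by (simp add: mult_ac)
  qed
  have "mat_vec (s ^ m) (A_mat s lam \<gamma> t (node s v d)) (C (node s v d)) a =
      (\<Sum>b\<in>set_digit s a v ` {..<s}. A_mat s lam \<gamma> t (node s v d) a b * C (node s v d) b)"
    unfolding mat_vec_def
    by (rule sum.mono_neutral_right)
      (use assms d in \<open>auto simp: set_digit_less image_iff A(5)[OF d d_def[symmetric]]\<close>)
  also have "\<dots> = (\<Sum>w<s. lam (node s v w) ^ t * C (node s v d) (set_digit s a v w))"
  proof (subst sum.reindex)
    show "inj_on (set_digit s a v) {..<s}"
      by (rule inj_on_inverseI[where g = "\<lambda>b. digit s b v"]) (simp add: digit_set_digit)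
  qed (simp add: A(3)[OF d d_def[symmetric]])
  finally have diag: "mat_vec (s ^ m) (A_mat s lam \<gamma> t (node s v d)) (C (node s v d)) a =
      (\<Sum>w<s. lam (node s v w) ^ t * C (node s v d) (set_digit s a v w))" .
  have "(\<Sum>u<s. mat_vec (s ^ m) (A_mat s lam \<gamma> t (node s v u)) (C (node s v u)) a) =
      (\<Sum>w<s. lam (node s v w) ^ t * C (node s v d) (set_digit s a v w)) +
      (\<Sum>u\<in>{..<s} - {d}. lam (node s v u) ^ t * (?e u * C (node s v u) a))"
    using d by (subst sum.remove[of _ d]) (simp_all add: off diag)
  \<comment> \<open>Replacing digit d by itself gives back \<open>a\<close>, so the summand w = d is
    an entry of row \<open>a\<close>; the other summands merge with the diagonal terms.\<close>
  also have "\<dots> = lam (node s v d) ^ t * C (node s v d) a +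
      (\<Sum>u\<in>{..<s} - {d}. lam (node s v u) ^ t * row_coeff s \<gamma> C a v u)"
    using d by (subst sum.remove[of _ d])
      (simp_all add: d_def set_digit_digit row_coeff_def algebra_simps flip: sum.distrib)
  also have "\<dots> = (\<Sum>u<s. lam (node s v u) ^ t * row_coeff s \<gamma> C a v u)"
    using d by (subst (2) sum.remove[of _ d]) (simp_all add: d_def row_coeff_def)
  finally show ?thesis .
qed

lemma parity_check_eq:
  assumes "0 < s" "a < s ^ m"
  shows "(\<Sum>i=1..s * m. mat_vec (s ^ m) (A_mat s lam \<gamma> t i) (C i) a) =
    (\<Sum>(v, u)\<in>{1..m} \<times> {..<s}. lam (node s v u) ^ t * row_coeff s \<gamma> C a v u)"
proof -
  have "(\<Sum>i=1..s * m. mat_vec (s ^ m) (A_mat s lam \<gamma> t i) (C i) a) =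
    (\<Sum>(v, u)\<in>{1..m} \<times> {..<s}. mat_vec (s ^ m) (A_mat s lam \<gamma> t (node s v u)) (C (node s v u)) a)"
    by (subst sum.reindex_bij_betw[OF bij_betw_node[OF assms(1)], symmetric])
      (simp add: case_prod_unfold)
  also have "\<dots> = (\<Sum>(v, u)\<in>{1..m} \<times> {..<s}. lam (node s v u) ^ t * row_coeff s \<gamma> C a v u)"
    unfolding sum.cartesian_product[symmetric] using assms by (intro sum.cong block_eq) auto
  finally show ?thesis .
qed

subsection \<open>Recovery from \<open>k\<close> columns\<close>

text \<open>This is the MDS property in linear form: it is applied to the difference of two
  codewords that agree on the complement of \<open>T\<close>.\<close>

lemma code_eq_zero:
  fixes lam :: "nat \<Rightarrow> 'a::field"
  assumes "0 < s" and inj: "inj_on lam {1..s * m}" and \<gamma>: "\<gamma> \<notin> {0, 1}"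
    and C: "C \<in> code s r m lam \<gamma>"
    and T: "T \<subseteq> {1..s * m}" "card T = r"
    and supp: "\<And>i. i \<notin> T \<Longrightarrow> C i = 0"
  shows "C = 0"
proof -
  define P where "P = {1..m} \<times> {..<s}"
  define T' where "T' = {(v, u) \<in> P. node s v u \<in> T}"
  have [simp]: "finite P" by (simp add: P_def)
  have bij: "bij_betw (\<lambda>(v, u). node s v u) P {1..s * m}"
    unfolding P_def by (rule bij_betw_node[OF \<open>0 < s\<close>])
  have "(\<lambda>(v, u). node s v u) ` T' = T"
  proof -
    have "T \<subseteq> (\<lambda>(v, u). node s v u) ` P"
      using T(1) bij_betw_imp_surj_on[OF bij] by simp
    then show ?thesis by (fastforce simp: T'_def)
  qed
  moreover have inj': "inj_on (\<lambda>(v, u). node s v u) T'"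
    by (rule inj_on_subset[OF bij_betw_imp_inj_on[OF bij]]) (auto simp: T'_def)
  ultimately have "card T' = r"
    using T(2) card_image by fastforce
  have "inj_on (lam \<circ> (\<lambda>(v, u). node s v u)) T'"
    by (rule comp_inj_on[OF inj'], rule inj_on_subset[OF inj])
      (use \<open>_ ` T' = T\<close> T(1) in simp)
  then have lam: "inj_on (\<lambda>(v, u). lam (node s v u)) T'"
    by (simp add: comp_def case_prod_unfold)
  have off: "C (node s v u) b = 0" if "(v, u) \<in> P - T'" for v u b
    using that supp by (auto simp: T'_def)
  have zero: "\<forall>(v, u)\<in>P. C (node s v u) a = 0" if "a < s ^ m" for a
    using that
  proof (induction "card {v\<in>{1..m}. (v, digit s a v) \<in> T'}" arbitrary: a rule: less_induct)
    case less
    \<comment> \<open>Stated for every row \<open>b\<close> with the same measure as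
      \<open>a\<close>, because the final separation of unknowns also needs the row obtained from
      \<open>a\<close> by changing one digit.\<close>
    have coeff: "row_coeff s \<gamma> C b v u = 0"
      if b: "b < s ^ m" and "(v, u) \<in> P"
        and card_b: "card {v\<in>{1..m}. (v, digit s b v) \<in> T'} =
          card {v\<in>{1..m}. (v, digit s a v) \<in> T'}" for b v u
    proof -
      have outside: "row_coeff s \<gamma> C b v u = 0" if vu: "(v, u) \<in> P - T'" for v u
      \<comment> \<open>In the first case every entry that occurs in the coefficient belongs to a
        column outside \<open>T'\<close>.\<close>
      proof (cases "u = digit s b v \<or> (v, digit s b v) \<notin> T'")
        case True
        moreover have "(v, digit s b v) \<in> P"
          using vu \<open>0 < s\<close> by (auto simp: P_def digit_less)
        ultimately show ?thesis
          using off[OF vu] off[of v "digit s b v"] by (auto simp: row_coeff_def)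
      next
        case False
        have v: "v \<in> {1..m}" and u: "u < s" using vu by (auto simp: P_def)
        let ?b = "set_digit s b v u"
        \<comment> \<open>Position \<open>v\<close> leaves the set, since \<open>(v, u)\<close> is
          outside \<open>T'\<close> while the old digit gave a member of \<open>T'\<close>; all
          other digits are unchanged. The induction hypothesis therefore applies to row
          \<open>?b\<close>.\<close>
        have "{w\<in>{1..m}. (w, digit s ?b w) \<in> T'} \<subset> {w\<in>{1..m}. (w, digit s b w) \<in> T'}"
        proof
          show "{w\<in>{1..m}. (w, digit s ?b w) \<in> T'} \<subseteq> {w\<in>{1..m}. (w, digit s b w) \<in> T'}"
          proof
            fix w assume "w \<in> {w\<in>{1..m}. (w, digit s ?b w) \<in> T'}"
            then show "w \<in> {w\<in>{1..m}. (w, digit s b w) \<in> T'}"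
              using vu v u by (cases "w = v") (auto simp: digit_set_digit digit_set_digit_other)
          qed
          show "{w\<in>{1..m}. (w, digit s ?b w) \<in> T'} \<noteq> {w\<in>{1..m}. (w, digit s b w) \<in> T'}"
          proof -
            have "v \<notin> {w\<in>{1..m}. (w, digit s ?b w) \<in> T'}"
              using vu u by (simp add: digit_set_digit)
            moreover have "v \<in> {w\<in>{1..m}. (w, digit s b w) \<in> T'}"
              using v False by simp
            ultimately show ?thesis by metis
          qed
        qed
        then have "card {w\<in>{1..m}. (w, digit s ?b w) \<in> T'} < card {w\<in>{1..m}. (w, digit s b w) \<in> T'}"
          by (rule psubset_card_mono[rotated]) simp
        then have "\<forall>(v, u)\<in>P. C (node s v u) ?b = 0"
          unfolding card_b by (rule less.hyps) (rule set_digit_less[OF b v u])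
        moreover have "(v, digit s b v) \<in> P"
          using False by (auto simp: T'_def)
        ultimately show ?thesis
          using off[OF vu] by (auto simp: row_coeff_def)
      qed
      \<comment> \<open>With the coefficients outside \<open>T'\<close> gone, row \<open>b\<close>
        is a square Vandermonde system: r equations in \<open>card T' = r\<close> unknowns.\<close>
      have sys: "(\<Sum>x\<in>T'. (\<lambda>(v, u). lam (node s v u)) x ^ t * (\<lambda>(v, u). row_coeff s \<gamma> C b v u) x) = 0"
        if "t < card T'" for t
      proof -
        have "(\<Sum>x\<in>T'. (\<lambda>(v, u). lam (node s v u)) x ^ t * (\<lambda>(v, u). row_coeff s \<gamma> C b v u) x) =
            (\<Sum>(v, u)\<in>P. lam (node s v u) ^ t * row_coeff s \<gamma> C b v u)"
          unfolding case_prod_unfold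
          by (rule sum.mono_neutral_left) (use outside in \<open>auto simp: T'_def\<close>)
        also have "\<dots> = (\<Sum>i=1..s * m. mat_vec (s ^ m) (A_mat s lam \<gamma> t i) (C i) b)"
          unfolding P_def by (rule parity_check_eq[OF \<open>0 < s\<close> b, symmetric])
        also have "\<dots> = 0"
          using C b that \<open>card T' = r\<close> by (simp add: code_def)
        finally show ?thesis .
      qed
      show ?thesis
      proof (cases "(v, u) \<in> T'")
        case True
        have "finite T'" by (rule finite_subset[of _ P]) (auto simp: T'_def)
        from vandermonde_system_zero[OF this lam sys True] show ?thesis by simp
      next
        case False
        then show ?thesis using outside that by simp
      qed
    qed
    show ?case
    proof clarify
      fix v u assume vu: "(v, u) \<in> P"
      define d where "d = digit s a v"
      define b where "b = set_digit s a v u"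
      have v: "v \<in> {1..m}" and u: "u < s" using vu by (auto simp: P_def)
      have d: "(v, d) \<in> P" "d < s"
        using v \<open>0 < s\<close> by (auto simp: P_def d_def digit_less)
      show "C (node s v u) a = 0"
      proof (cases "(v, u) \<in> T'")
        case False
        then show ?thesis using off vu by simp
      next
        case uT: True
        note a0 = coeff[OF less.prems vu refl]
        show ?thesis
        proof (cases "u = d")
          case True
          then show ?thesis using a0 by (simp add: row_coeff_def d_def)
        next
          case ud: False
          show ?thesis
          proof (cases "(v, d) \<in> T'")
            case False
            \<comment> \<open>Column \<open>(v, d)\<close> vanishes, which leaves 1 or \<gamma>
              times the wanted entry; here \<gamma> must be nonzero.\<close>
            then show ?thesis
              using a0 ud off[of v d b] d \<gamma>
              by (auto simp: row_coeff_def d_def b_def split: if_splits)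
          next
            case True
            \<comment> \<open>Both \<open>(v, u)\<close> and \<open>(v, d)\<close> lie in
              \<open>T'\<close>, so exchanging the digit d for u keeps the measure and
              \<open>coeff\<close> covers row \<open>b\<close> as well.\<close>
            have "{w\<in>{1..m}. (w, digit s b w) \<in> T'} = {w\<in>{1..m}. (w, digit s a w) \<in> T'}"
            proof (intro Collect_cong conj_cong refl)
              fix w assume "w \<in> {1..m}"
              then show "(w, digit s b w) \<in> T' \<longleftrightarrow> (w, digit s a w) \<in> T'"
                using v u uT True unfolding b_def d_def
                by (cases "w = v") (auto simp: digit_set_digit digit_set_digit_other)
            qed
            then have b0: "row_coeff s \<gamma> C b v d = 0"
              by (intro coeff d) (use set_digit_less[OF less.prems v u] in \<open>simp_all add: b_def\<close>)
            have "digit s b v = u" "set_digit s b v d = a"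
              using u by (simp_all add: b_def d_def digit_set_digit set_digit_set_digit set_digit_digit)
            \<comment> \<open>Rows \<open>a\<close> and \<open>b\<close> involve the same two
              unknowns with the roles of u and d swapped. Hence one equation has coefficients 1, 1
              and the other 1, \<gamma>, and the determinant is 1 - \<gamma> up to sign.\<close>
            then have 1: "(if u < d then 1 else \<gamma>) * C (node s v d) b + C (node s v u) a = 0"
              using b0 ud by (simp add: row_coeff_def)
            have 2: "(if d < u then 1 else \<gamma>) * C (node s v u) a + C (node s v d) b = 0"
              using a0 ud by (simp add: row_coeff_def flip: d_def b_def)
            have "(1 - \<gamma>) * C (node s v u) a = 0"
            proof (cases "u < d")
              case True
              have "(1 - \<gamma>) * C (node s v u) a =
                  (C (node s v d) b + C (node s v u) a) - (\<gamma> * C (node s v u) a + C (node s v d) b)"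
                by (simp add: algebra_simps)
              moreover have "C (node s v d) b + C (node s v u) a = 0"
                "\<gamma> * C (node s v u) a + C (node s v d) b = 0"
                using 1 2 True by simp_all
              ultimately show ?thesis by (simp only: diff_self)
            next
              case False
              have "(1 - \<gamma>) * C (node s v u) a =
                  (\<gamma> * C (node s v d) b + C (node s v u) a) - \<gamma> * (C (node s v u) a + C (node s v d) b)"
                by (simp add: algebra_simps)
              moreover have "\<gamma> * C (node s v d) b + C (node s v u) a = 0"
                "C (node s v u) a + C (node s v d) b = 0"
                using 1 2 False ud by simp_all
              ultimately show ?thesis by (simp only: diff_self mult_zero_right)
            qed
            then show ?thesis using \<gamma> by simp
          qed
        qed
      qed
    qed
  qed
  have space: "C \<in> array_space (s * m) (s ^ m)" using C by (simp add: code_def)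
  have "C i a = 0" for i a
  proof (cases "i \<in> {1..s * m} \<and> a < s ^ m")
    case True
    then obtain v u where "(v, u) \<in> P" "i = node s v u"
      using bij_betw_imp_surj_on[OF bij] by force
    then show ?thesis using zero True by auto
  next
    case False
    then show ?thesis using space by (auto simp: array_space_def)
  qed
  then show ?thesis by (simp add: fun_eq_iff)
qed

subsection \<open>Dimension\<close>

text \<open>Adjoining \<open>b\<close> to an independent set multiplies the size of the span by that
  of the field: each element is c b + x for a unique scalar c and a unique x in the old span, as two
  different scalars would put \<open>b\<close> into that span.\<close>

lemma (in vector_space) card_span:
  assumes "finite (UNIV :: 'a set)" "finite B" "independent B"
  shows "card (span B) = card (UNIV :: 'a set) ^ card B"
  using assms(2,3)
proof (induction rule: finite_induct)
  case (insert b B)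
  have b: "b \<notin> span B" and "independent B"
    using insert by (auto simp: independent_insert)
  have "bij_betw (\<lambda>(c, x). scale c b + x) (UNIV \<times> span B) (span (insert b B))"
  proof (rule bij_betw_imageI)
    show "inj_on (\<lambda>(c, x). scale c b + x) (UNIV \<times> span B)"
    proof (rule inj_onI, clarify)
      fix c x c' x'
      assume x: "x \<in> span B" "x' \<in> span B" and eq: "scale c b + x = scale c' b + x'"
      have "scale (c - c') b = x' - x"
        using eq by (simp add: scale_left_diff_distrib algebra_simps)
      then have "scale (c - c') b \<in> span B"
        using x by (simp add: span_diff)
      then have "c = c'"
        using b span_scale[of "scale (c - c') b" B "inverse (c - c')"] by (cases "c = c'") auto
      then show "c = c' \<and> x = x'" using eq by simp
    qed
    show "(\<lambda>(c, x). scale c b + x) ` (UNIV \<times> span B) = span (insert b B)"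
    proof (intro equalityI subsetI)
      fix y assume "y \<in> span (insert b B)"
      then obtain c where "y - scale c b \<in> span B"
        by (auto simp: span_insert)
      then show "y \<in> (\<lambda>(c, x). scale c b + x) ` (UNIV \<times> span B)"
        by (intro image_eqI[of _ _ "(c, y - scale c b)"]) auto
    next
      fix y assume "y \<in> (\<lambda>(c, x). scale c b + x) ` (UNIV \<times> span B)"
      then obtain c x where "x \<in> span B" "y = scale c b + x" by auto
      then have "y - scale c b \<in> span B" by simp
      then show "y \<in> span (insert b B)" by (auto simp: span_insert)
    qed
  qed
  then have "card (span (insert b B)) = card (UNIV \<times> span B :: ('a \<times> 'b) set)"
    by (rule bij_betw_same_card[symmetric])
  then show ?case
    using insert \<open>independent B\<close> by (simp add: card_cartesian_product)
qed simp

text \<open>Reduces the computation of a dimension to counting.\<close>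

lemma (in vector_space) card_subspace:
  assumes "finite (UNIV :: 'a set)" "subspace V" "finite V"
  shows "card V = card (UNIV :: 'a set) ^ dim V"
proof -
  obtain B where B: "B \<subseteq> V" "independent B" "V \<subseteq> span B" "card B = dim V"
    using basis_exists by blast
  then have "span B = V"
    using assms(2) by (simp add: span_subspace)
  then show ?thesis
    using card_span[OF assms(1) _ B(2)] B assms(3) finite_subset by metis
qed

text \<open>Arrays are 0 outside their index range, extensional functions are
  \<open>undefined\<close> there; the bijection exchanges the two default values so that
  \<open>card_PiE\<close> applies.\<close>

lemma bij_betw_arrays_PiE:
  "bij_betw (\<lambda>C. \<lambda>(i, a)\<in>I \<times> J. C i a)
    {C :: 'a::zero array. \<forall>i a. i \<notin> I \<or> a \<notin> J \<longrightarrow> C i a = 0} (I \<times> J \<rightarrow>\<^sub>E UNIV)"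
proof (rule bij_betwI[where g = "\<lambda>f i a. if (i, a) \<in> I \<times> J then f (i, a) else 0"])
  fix C :: "'a array"
  assume "C \<in> {C. \<forall>i a. i \<notin> I \<or> a \<notin> J \<longrightarrow> C i a = 0}"
  then show "(\<lambda>i a. if (i, a) \<in> I \<times> J then (\<lambda>(i, a)\<in>I \<times> J. C i a) (i, a) else 0) = C"
    by (auto simp: fun_eq_iff)
next
  fix f :: "nat \<times> nat \<Rightarrow> 'a"
  assume "f \<in> I \<times> J \<rightarrow>\<^sub>E UNIV"
  then show "(\<lambda>(i, a)\<in>I \<times> J. if (i, a) \<in> I \<times> J then f (i, a) else 0) = f"
    by (auto simp: fun_eq_iff PiE_def extensional_def restrict_def)
qed auto

text \<open>The index sets are arbitrary because three spaces are counted: all arrays, the possible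
  values of the parity checks, and the arrays supported on a given set of columns.\<close>

lemma card_arrays:
  assumes "finite I" "finite J"
  shows "card {C :: 'a::{zero, finite} array. \<forall>i a. i \<notin> I \<or> a \<notin> J \<longrightarrow> C i a = 0} =
    CARD('a) ^ (card I * card J)"
    and "finite {C :: 'a::{zero, finite} array. \<forall>i a. i \<notin> I \<or> a \<notin> J \<longrightarrow> C i a = 0}"
  using bij_betw_same_card[OF bij_betw_arrays_PiE[of I J, where 'a = 'a]]
    bij_betw_finite[OF bij_betw_arrays_PiE[of I J, where 'a = 'a]] assms
  by (simp_all add: card_PiE card_cartesian_product finite_PiE)

lemma array_space_eq:
  "array_space n l = {C. \<forall>i a. i \<notin> {1..n} \<or> a \<notin> {..<l} \<longrightarrow> C i a = 0}"
  by (simp add: array_space_def not_less)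

lemma finite_array_space: "finite (array_space n l :: 'a::{field, finite} array set)"
  unfolding array_space_eq by (rule card_arrays) auto

lemma card_array_space:
  "card (array_space n l :: 'a::{field, finite} array set) = CARD('a) ^ (n * l)"
  unfolding array_space_eq by (subst card_arrays) auto

lemma mat_vec_add: "mat_vec l A (x + y) a = mat_vec l A x a + mat_vec l A y a"
  by (simp add: mat_vec_def algebra_simps sum.distrib)

lemma mat_vec_diff: "mat_vec l A (x - y) a = mat_vec l A x a - mat_vec l A y a"
  by (simp add: mat_vec_def algebra_simps sum_subtractf)

lemma mat_vec_scale: "mat_vec l A (\<lambda>b. c * x b) a = c * mat_vec l A x a"
  by (simp add: mat_vec_def algebra_simps sum_distrib_left)

lemma subspace_array_space: "arr.subspace (array_space n l)"
  by (auto simp: arr.subspace_def array_space_def array_scale_def)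

lemma subspace_code: "arr.subspace (code s r m lam \<gamma>)"
proof (rule arr.subspaceI)
  show "0 \<in> code s r m lam \<gamma>"
    by (simp add: code_def array_space_def mat_vec_def)
next
  fix C D assume "C \<in> code s r m lam \<gamma>" "D \<in> code s r m lam \<gamma>"
  then show "C + D \<in> code s r m lam \<gamma>"
    by (simp add: code_def arr.subspace_add[OF subspace_array_space] mat_vec_add sum.distrib)
next
  fix c C assume "C \<in> code s r m lam \<gamma>"
  then show "array_scale c C \<in> code s r m lam \<gamma>"
    using arr.subspace_scale[OF subspace_array_space, of C "s * m" "s ^ m" c]
    by (simp add: code_def array_scale_def mat_vec_scale flip: sum_distrib_left)
qed

text \<open>The code is the kernel of the linear parity check map, and no fibre is larger than the
  kernel. The product form avoids dividing cardinalities.\<close>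

lemma card_code_ge:
  fixes lam :: "nat \<Rightarrow> 'a::{field, finite}"
  shows "CARD('a) ^ (s * m * s ^ m) \<le> CARD('a) ^ (r * s ^ m) * card (code s r m lam \<gamma>)"
proof -
  let ?V = "array_space (s * m) (s ^ m) :: 'a array set"
  define W where "W = {C :: 'a array. \<forall>i a. i \<notin> {..<r} \<or> a \<notin> {..<s ^ m} \<longrightarrow> C i a = 0}"
  \<comment> \<open>The value 0 outside the range places \<open>L C\<close> in \<open>W\<close> and
    makes \<open>L C = 0\<close> equivalent to all parity checks.\<close>
  define L where "L C = (\<lambda>t a. if t < r \<and> a < s ^ m
    then (\<Sum>i=1..s * m. mat_vec (s ^ m) (A_mat s lam \<gamma> t i) (C i) a) else 0)" for C
  have W: "card W = CARD('a) ^ (r * s ^ m)" "finite W"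
    unfolding W_def using card_arrays[of "{..<r}" "{..<s ^ m}"] by simp_all
  have code: "C \<in> code s r m lam \<gamma> \<longleftrightarrow> C \<in> ?V \<and> L C = 0" for C
    by (auto simp: code_def L_def fun_eq_iff)
  have fibre: "card {C \<in> ?V. L C = w} \<le> card (code s r m lam \<gamma>)" for w
  proof (cases "\<exists>D\<in>?V. L D = w")
    case True
    then obtain D where D: "D \<in> ?V" "L D = w" by blast
    \<comment> \<open>Translation by a fixed element of the fibre carries the fibre injectively into
      the kernel.\<close>
    have "(\<lambda>C. C - D) ` {C \<in> ?V. L C = w} \<subseteq> code s r m lam \<gamma>"
    proof clarify
      fix C assume C: "C \<in> ?V" "w = L C"
      have "L (C - D) = L C - L D"
        by (auto simp: L_def fun_eq_iff mat_vec_diff sum_subtractf)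
      then show "C - D \<in> code s r m lam \<gamma>"
        using C D by (simp add: code arr.subspace_diff[OF subspace_array_space])
    qed
    then show ?thesis
      by (rule card_inj_on_le[rotated])
        (auto intro: inj_onI finite_subset[OF _ finite_array_space] simp: code)
  next
    case False
    then have "{C \<in> ?V. L C = w} = {}" by blast
    then show ?thesis by (simp only: card.empty le0)
  qed
  have "?V = (\<Union>w\<in>W. {C \<in> ?V. L C = w})"
    by (auto simp: W_def L_def)
  then have "card ?V \<le> (\<Sum>w\<in>W. card {C \<in> ?V. L C = w})"
    by (metis (no_types) card_UN_le W(2))
  also have "\<dots> \<le> card W * card (code s r m lam \<gamma>)"
    using sum_bounded_above[OF fibre] by simp
  finally show ?thesis
    by (simp add: card_array_space W(1))
qed

text \<open>The Singleton bound: erasing all columns outside \<open>S\<close> is injective on the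
  code.\<close>

lemma card_code_le:
  fixes \<C> :: "'a::{field, finite} array set"
  assumes "\<C> \<subseteq> array_space n l" "S \<subseteq> {1..n}"
    and determined: "\<And>C D. C \<in> \<C> \<Longrightarrow> D \<in> \<C> \<Longrightarrow> \<forall>i\<in>S. C i = D i \<Longrightarrow> C = D"
  shows "card \<C> \<le> CARD('a) ^ (card S * l)"
proof -
  let ?W = "{C :: 'a array. \<forall>i a. i \<notin> S \<or> a \<notin> {..<l} \<longrightarrow> C i a = 0}"
  let ?f = "\<lambda>C i. if i \<in> S then C i else (\<lambda>a. 0 :: 'a)"
  have "finite S" using assms(2) finite_subset by blast
  have "inj_on ?f \<C>"
  proof (rule inj_onI)
    fix C D assume "C \<in> \<C>" "D \<in> \<C>" and eq: "?f C = ?f D"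
    have "\<forall>i\<in>S. C i = D i"
      using fun_cong[OF eq] by (metis (full_types))
    then show "C = D" using \<open>C \<in> \<C>\<close> \<open>D \<in> \<C>\<close> determined by blast
  qed
  moreover have "?f ` \<C> \<subseteq> ?W"
    using assms(1) by (auto simp: array_space_def)
  ultimately have "card \<C> \<le> card ?W"
    by (rule card_inj_on_le) (rule card_arrays(2), use \<open>finite S\<close> in auto)
  also have "\<dots> = CARD('a) ^ (card S * l)"
    using \<open>finite S\<close> by (subst card_arrays) auto
  finally show ?thesis .
qed

theorem theorem1:
  fixes s r m n k l :: nat
    and lam :: "nat \<Rightarrow> 'a::{field, finite}"
    and \<gamma> :: 'a
  assumes "0 < s" "0 < r" "0 < m"
    and "s \<le> r" "r \<le> s * m"
    and "n = s * m" "k = n - r" "l = s ^ m"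
    and "card (UNIV :: 'a set) \<ge> n"
    and "inj_on lam {1..n}"
    and "\<gamma> \<notin> {0, 1}"
  shows "MDS_array_code n k l (code s r m lam \<gamma>)"
proof -
  let ?C = "code s r m lam \<gamma>"
  have sub: "?C \<subseteq> array_space n l"
    using assms by (auto simp: code_def)
  have determined: "C = D"
    if S: "S \<subseteq> {1..n}" "card S = k" and CD: "C \<in> ?C" "D \<in> ?C" and eq: "\<forall>i\<in>S. C i = D i"
    for S C D
  proof -
    have "C - D = 0"
    proof (rule code_eq_zero[where T = "{1..n} - S"])
      show "C - D \<in> ?C" using arr.subspace_diff[OF subspace_code] CD by blast
      \<comment> \<open>Since r \<le> n, the truncated difference n - (n - r) is r.\<close>
      show "card ({1..n} - S) = r"
        using S assms by (simp add: card_Diff_subset finite_subset[OF S(1)])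
      show "(C - D) i = 0" if "i \<notin> {1..n} - S" for i
        using that eq subsetD[OF sub CD(1)] subsetD[OF sub CD(2)]
        by (auto simp: array_space_def fun_eq_iff)
    qed (use assms in auto)
    then show ?thesis by simp
  qed
  have "finite ?C"
    using sub finite_array_space finite_subset by blast
  then have card_code: "card ?C = CARD('a) ^ arr.dim ?C"
    by (intro arr.card_subspace subspace_code) simp_all
  have q: "1 < CARD('a)"
    using card_mono[of UNIV "{0, 1 :: 'a}"] by simp
  have "CARD('a) ^ (n * l) \<le> CARD('a) ^ (r * l + arr.dim ?C)"
    using card_code_ge[of s m r lam \<gamma>] assms by (simp add: card_code power_add)
  then have "n * l \<le> r * l + arr.dim ?C"
    using q by (simp add: power_increasing_iff)
  then have ge: "k * l \<le> arr.dim ?C"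
    using assms(7) by (simp add: diff_mult_distrib)
  \<comment> \<open>Any set of k columns would serve; the first k are available because k \<le>
    n.\<close>
  have "card ?C \<le> CARD('a) ^ (card {1..k} * l)"
    by (rule card_code_le[OF sub]) (use assms determined[of "{1..k}"] in auto)
  then have "arr.dim ?C \<le> k * l"
    using q by (simp add: card_code power_increasing_iff)
  then have "array_code n k l ?C"
    using ge sub subspace_code by (simp add: array_code_def)
  then show ?thesis
    unfolding MDS_array_code_def using determined by blast
qed

end
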